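(* Let $\mathcal{A}$ and $\mathcal{U}$ be Banach algebras such that $\mathcal{U}$ is a Banach $\mathcal{A}$-bimodule with compatible actions and norm, and let $D$ be a derivation on $\mathcal{A}\ltimes\mathcal{U}$ written as $$D((a,x))=(\delta_1(a)+\tau_1(x),\,\delta_2(a)+\tau_2(x))\qquad((a,x)\in\mathcal{A}\ltimes\mathcal{U}).$$ Then: (i) If $ann_{\mathcal{U}}\mathcal{U}=(0)$, $x\tau_1(y)+\tau_1(x)y=0$ for all $x,y\in\mathcal{U}$, and $\delta_1$ and $\tau_2$ are continuous, then $D=D_1+D_2$, where $$D_1((a,x))=(\delta_1(a),\,\delta_2(a)+\tau_2(x))\quad\text{and}\quad D_2((a,x))=(\tau_1(x),0)$$ are derivations on $\mathcal{A}\ltimes\mathcal{U}$ and $D_1$ is continuous. (ii) If $ann_{\mathcal{U}}\mathcal{U}=(0)$, $\delta_1(\mathcal{A})\subseteq ann_{\mathcal{A}}\mathcal{U}$, and $\tau_1,\tau_2$ are continuous, then $D_1((a,x))=(\tau_1(x),\,\delta_2(a)+\tau_2(x))$ is a continuous derivation on $\mathcal{A}\ltimes\mathcal{U}$ and $D=D_1+D_2$, where $D_2((a,x))=(\delta_1(a),0)$ is a derivation on $\mathcal{A}\ltimes\mathcal{U}$.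
   Context: All algebras are over $\mathbb{C}$. "Banach $\mathcal{A}$-bimodule with compatible actions and norm" means: $\|ax\|\le\|a\|\|x\|$, $\|xa\|\le\|x\|\|a\|$, and $a(xy)=(ax)y$, $(xy)a=x(ya)$, $(xa)y=x(ay)$ for all $a\in\mathcal{A}$, $x,y\in\mathcal{U}$. The semidirect product $\mathcal{A}\ltimes\mathcal{U}$ is $\mathcal{A}\times\mathcal{U}$ with multiplication $(a,x)(b,y)=(ab,\,ay+xb+xy)$ and norm $\|(a,x)\|=\|a\|+\|x\|$. A derivation on an algebra $\mathcal{B}$ is a linear map $D:\mathcal{B}\to\mathcal{B}$ (not assumed continuous) with $D(bc)=bD(c)+D(b)c$. The linear maps $\delta_1:\mathcal{A}\to\mathcal{A}$, $\delta_2:\mathcal{A}\to\mathcal{U}$, $\tau_1:\mathcal{U}\to\mathcal{A}$, $\tau_2:\mathcal{U}\to\mathcal{U}$ are the components of $D$: $D((a,0))=(\delta_1(a),\delta_2(a))$ and $D((0,x))=(\tau_1(x),\tau_2(x))$. Further, $ann_{\mathcal{A}}\mathcal{U}=\{a\in\mathcal{A}\mid a\mathcal{U}=\mathcal{U}a=(0)\}$ and $ann_{\mathcal{U}}\mathcal{U}=\{x\in\mathcal{U}\mid x\mathcal{U}=\mathcal{U}x=(0)\}$. *)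

theory Defs
  imports "HOL-Analysis.Analysis"
begin

class complex_vector = real_vector +
  fixes scaleC :: "complex \<Rightarrow> 'a \<Rightarrow> 'a"  (infixr "*\<^sub>C" 75)
  assumes scaleC_add_right: "c *\<^sub>C (x + y) = c *\<^sub>C x + c *\<^sub>C y"
    and scaleC_add_left: "(c + d) *\<^sub>C x = c *\<^sub>C x + d *\<^sub>C x"
    and scaleC_scaleC: "c *\<^sub>C (d *\<^sub>C x) = (c * d) *\<^sub>C x"
    and scaleC_one: "1 *\<^sub>C x = x"
    and scaleR_eq_scaleC: "r *\<^sub>R x = complex_of_real r *\<^sub>C x"

lemma vector_space_scaleC: "vector_space (scaleC :: complex \<Rightarrow> 'a::complex_vector \<Rightarrow> 'a)"
  by unfold_locales (simp_all add: scaleC_add_right scaleC_add_left scaleC_scaleC scaleC_one)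

instantiation prod :: (complex_vector, complex_vector) complex_vector
begin

definition scaleC_prod_def: "c *\<^sub>C p = (c *\<^sub>C fst p, c *\<^sub>C snd p)"

instance
  by standard (simp_all add: scaleC_prod_def prod_eq_iff scaleC_add_right scaleC_add_left
      scaleC_scaleC scaleC_one scaleR_eq_scaleC)

end

abbreviation clinear :: "('a::complex_vector \<Rightarrow> 'b::complex_vector) \<Rightarrow> bool"
  where "clinear \<equiv> Vector_Spaces.linear scaleC scaleC"

(* The class real_normed_algebra provides associativity, distributivity and
   norm (x * y) <= norm x * norm y; a unit is not required. *)
class complex_banach_algebra = complex_vector + real_normed_algebra + banach +
  assumes mult_scaleC_left: "(c *\<^sub>C x) * y = c *\<^sub>C (x * y)"
    and mult_scaleC_right: "x * (c *\<^sub>C y) = c *\<^sub>C (x * y)"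
    and norm_scaleC: "norm (c *\<^sub>C x) = cmod c * norm x"

locale compatible_banach_bimodule =
  fixes lact :: "'a::complex_banach_algebra \<Rightarrow> 'u::complex_banach_algebra \<Rightarrow> 'u"
    and ract :: "'u \<Rightarrow> 'a \<Rightarrow> 'u"
  assumes clinear_lact_left: "clinear (\<lambda>a. lact a x)"
    and clinear_lact_right: "clinear (\<lambda>x. lact a x)"
    and clinear_ract_left: "clinear (\<lambda>x. ract x a)"
    and clinear_ract_right: "clinear (\<lambda>a. ract x a)"
    and lact_mult: "lact (a * b) x = lact a (lact b x)"
    and ract_mult: "ract x (a * b) = ract (ract x a) b"
    and lact_ract: "ract (lact a x) b = lact a (ract x b)"
    and norm_lact: "norm (lact a x) \<le> norm a * norm x"
    and norm_ract: "norm (ract x a) \<le> norm x * norm a"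
    and lact_mult_compat: "lact a (x * y) = lact a x * y"
    and ract_mult_compat: "ract (x * y) a = x * ract y a"
    and middle_compat: "ract x a * y = x * lact a y"

definition semidirect_mult ::
  "('a::complex_banach_algebra \<Rightarrow> 'u::complex_banach_algebra \<Rightarrow> 'u) \<Rightarrow> ('u \<Rightarrow> 'a \<Rightarrow> 'u)
    \<Rightarrow> 'a \<times> 'u \<Rightarrow> 'a \<times> 'u \<Rightarrow> 'a \<times> 'u"
  where "semidirect_mult lact ract = (\<lambda>(a, x) (b, y). (a * b, lact a y + ract x b + x * y))"

(* The norm that the library puts on the product type is the Euclidean one, so the
   sum norm and the topology it induces are introduced separately. *)
definition semidirect_norm :: "'a::complex_banach_algebra \<times> 'u::complex_banach_algebra \<Rightarrow> real"
  where "semidirect_norm = (\<lambda>(a, x). norm a + norm x)"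

definition semidirect_dist ::
  "'a::complex_banach_algebra \<times> 'u::complex_banach_algebra \<Rightarrow> 'a \<times> 'u \<Rightarrow> real"
  where "semidirect_dist p q = semidirect_norm (p - q)"

lemma Metric_space_semidirect:
  "Metric_space UNIV
    (semidirect_dist :: 'a::complex_banach_algebra \<times> 'u::complex_banach_algebra \<Rightarrow> _)"
proof
  fix p q r :: "'a \<times> 'u"
  show "0 \<le> semidirect_dist p q"
    by (simp add: semidirect_dist_def semidirect_norm_def split_beta)
  show "semidirect_dist p q = semidirect_dist q p"
    by (simp add: semidirect_dist_def semidirect_norm_def split_beta norm_minus_commute)
  show "semidirect_dist p q = 0 \<longleftrightarrow> p = q"
    by (simp add: semidirect_dist_def semidirect_norm_def split_beta prod_eq_iff
        add_nonneg_eq_0_iff)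
  show "semidirect_dist p r \<le> semidirect_dist p q + semidirect_dist q r"
    using dist_triangle[of "fst p" "fst r" "fst q"] dist_triangle[of "snd p" "snd r" "snd q"]
    by (simp add: semidirect_dist_def semidirect_norm_def split_beta dist_norm)
qed

definition semidirect_topology ::
  "('a::complex_banach_algebra \<times> 'u::complex_banach_algebra) topology"
  where "semidirect_topology = Metric_space.mtopology UNIV semidirect_dist"

context compatible_banach_bimodule
begin

lemma semidirect_mult_assoc:
  "semidirect_mult lact ract (semidirect_mult lact ract p q) r
    = semidirect_mult lact ract p (semidirect_mult lact ract q r)"
proof -
  have "lact a (x + y) = lact a x + lact a y" for a x y
    by (rule module_hom.add[OF Vector_Spaces.linear.axioms(3)[OF clinear_lact_right]])
  moreover have "ract (x + y) a = ract x a + ract y a" for a x y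
    by (rule module_hom.add[OF Vector_Spaces.linear.axioms(3)[OF clinear_ract_left]])
  ultimately show ?thesis
    by (auto simp: semidirect_mult_def split_beta algebra_simps lact_mult ract_mult lact_ract
        lact_mult_compat ract_mult_compat middle_compat)
qed

lemma semidirect_norm_mult:
  "semidirect_norm (semidirect_mult lact ract p q) \<le> semidirect_norm p * semidirect_norm q"
proof -
  obtain a x b y where [simp]: "p = (a, x)" "q = (b, y)" by fastforce
  have "norm (lact a y + ract x b + x * y) \<le> norm a * norm y + norm x * norm b + norm x * norm y"
    by (intro norm_triangle_le add_mono norm_lact norm_ract norm_mult_ineq)
  with norm_mult_ineq[of a b] show ?thesis
    by (simp add: semidirect_mult_def semidirect_norm_def algebra_simps)
qed

end

(* m is the multiplication of the algebra; D is not assumed continuous. *)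
definition derivation :: "('b::complex_vector \<Rightarrow> 'b \<Rightarrow> 'b) \<Rightarrow> ('b \<Rightarrow> 'b) \<Rightarrow> bool"
  where "derivation m D \<longleftrightarrow> clinear D \<and> (\<forall>b c. D (m b c) = m b (D c) + m (D b) c)"

definition ann_module ::
  "('a::complex_banach_algebra \<Rightarrow> 'u::complex_banach_algebra \<Rightarrow> 'u) \<Rightarrow> ('u \<Rightarrow> 'a \<Rightarrow> 'u) \<Rightarrow> 'a set"
  where "ann_module lact ract = {a. \<forall>x. lact a x = 0 \<and> ract x a = 0}"

definition ann_self :: "'u::complex_banach_algebra set"
  where "ann_self = {x. \<forall>y. x * y = 0 \<and> y * x = 0}"

end

theory Submission
  imports Defs
begin

text \<open>
  Tested on products of elements \<open>(a, 0)\<close> and \<open>(0, x)\<close>, the Leibniz rule for \<open>D\<close> becomes a system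
  of identities between the components.  In this system \<open>\<tau>\<^sub>1\<close> meets the other maps only through
  \<open>x \<tau>\<^sub>1(y) + \<tau>\<^sub>1(x) y\<close> in the rule for \<open>\<tau>\<^sub>2(x y)\<close>, and \<open>\<delta>\<^sub>1\<close> meets them only through its action on
  the module in the rules for \<open>\<tau>\<^sub>2(a y)\<close> and \<open>\<tau>\<^sub>2(x b)\<close>.  The hypotheses of the two parts make
  exactly these terms vanish, so the system splits and \<open>\<tau>\<^sub>1\<close>, respectively \<open>\<delta>\<^sub>1\<close>, can be detached
  as a derivation of its own (\<open>derivation_block_map_iff\<close>).

  What remains is the continuity of \<open>\<delta>\<^sub>2\<close>.  Solved for the product, the rules for \<open>\<tau>\<^sub>2\<close> read
  \<open>\<delta>\<^sub>2(a) y = \<tau>\<^sub>2(a y) - a \<tau>\<^sub>2(y) - \<delta>\<^sub>1(a) y\<close> and likewise for \<open>y \<delta>\<^sub>2(a)\<close>, and the right-hand sides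
  are continuous in \<open>a\<close>.  If \<open>a\<^sub>n \<rightarrow> 0\<close> and \<open>\<delta>\<^sub>2(a\<^sub>n) \<rightarrow> z\<close>, then \<open>z y = y z = 0\<close> for all \<open>y\<close>, and \<open>z = 0\<close>
  because the annihilator is trivial.  Thus \<open>\<delta>\<^sub>2\<close> has closed graph and is continuous by the closed
  graph theorem, which is derived here from the Baire category theorem
  (\<open>closed_graph_imp_bounded_linear\<close>).
\<close>

section \<open>The closed graph theorem for Banach spaces\<close>

text \<open>
  By the Baire category theorem the closure of \<open>{x. norm (T x) \<le> n}\<close> contains a ball for some
  \<open>n\<close>.  Differences of points near its centre and near a translate of the centre approximate any
  vector after scaling, which moves the ball to the origin.
\<close>
lemma linear_almost_bounded:
  fixes T :: "'a::banach \<Rightarrow> 'b::real_normed_vector"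
  assumes "linear T"
  shows "\<exists>C\<ge>0. \<forall>x. \<forall>\<epsilon>>0. \<exists>y. norm (y - x) < \<epsilon> \<and> norm (T y) \<le> C * norm x"
proof -
  interpret T: linear T by fact
  define A where "A n = closure {x. norm (T x) \<le> real n}" for n
  have "x \<in> \<Union>(range A)" for x
  proof -
    obtain n where "norm (T x) \<le> real n" using real_arch_simple by blast
    then have "x \<in> A n" unfolding A_def by (intro subsetD[OF closure_subset]) simp
    then show ?thesis by blast
  qed
  then have cover: "\<Union>(range A) = UNIV" by blast
  have "\<exists>n. interior (A n) \<noteq> {}"
  proof (rule ccontr)
    assume "\<not> ?thesis"
    then have "Met_TC.mtopology interior_of \<Union>(range A) = {}"
      by (intro Met_TC.metric_Baire_category_alt)
        (auto simp: A_def complete_UNIV mcomplete_iff_complete)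
    with cover show False by simp
  qed
  then obtain n a r where r: "r > 0" and ball: "ball a r \<subseteq> A n"
    by (metis ex_in_conv mem_interior)
  \<comment> \<open>A vector is scaled to length \<open>r / 2\<close>, which keeps its translate by \<open>a\<close> inside the ball; the
    difference of two vectors whose images have norm at most \<open>n\<close> is then scaled back.\<close>
  define C where "C = 4 * real n / r"
  have "\<exists>y. norm (y - x) < \<epsilon> \<and> norm (T y) \<le> C * norm x" if "\<epsilon> > 0" for x \<epsilon>
  proof (cases "x = 0")
    case True
    with that show ?thesis by (intro exI[of _ 0]) (simp add: T.zero)
  next
    case False
    define s where "s = r / (2 * norm x)"
    have s: "s > 0" using r False by (simp add: s_def)
    have "norm (s *\<^sub>R x) = r / 2" using r False by (simp add: s_def)
    then have "a \<in> A n" "a + s *\<^sub>R x \<in> A n" using ball r by (auto simp: dist_norm)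
    moreover have "s * \<epsilon> / 2 > 0" using s that by simp
    ultimately obtain u v where
      u: "norm (T u) \<le> real n" "norm (u - (a + s *\<^sub>R x)) < s * \<epsilon> / 2" and
      v: "norm (T v) \<le> real n" "norm (v - a) < s * \<epsilon> / 2"
      unfolding A_def closure_approachable dist_norm by blast
    define y where "y = (1 / s) *\<^sub>R (u - v)"
    have "y - x = (1 / s) *\<^sub>R ((u - (a + s *\<^sub>R x)) - (v - a))"
      using s by (simp add: y_def algebra_simps)
    then have "norm (y - x) = norm ((u - (a + s *\<^sub>R x)) - (v - a)) / s"
      using s by simp
    also have "\<dots> < \<epsilon>"
      using norm_triangle_ineq4[of "u - (a + s *\<^sub>R x)" "v - a"] u v s
      by (simp add: divide_simps mult.commute)
    finally have 1: "norm (y - x) < \<epsilon>" .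
    have "norm (T y) = norm (T u - T v) / s"
      using s by (simp add: y_def T.scaleR T.diff)
    also have "\<dots> \<le> (2 * real n) / s"
      using norm_triangle_ineq4[of "T u" "T v"] u v s by (intro divide_right_mono) auto
    also have "\<dots> = C * norm x"
      using r False by (simp add: C_def s_def)
    finally show ?thesis using 1 by blast
  qed
  moreover have "C \<ge> 0" using r by (simp add: C_def)
  ultimately show ?thesis by blast
qed

text \<open>
  Approximating \<open>x\<close>, then the remainder, and so on, with \<open>k\<close>-th remainder at most \<open>norm x / 2 ^ k\<close>, writes
  \<open>x\<close> as a series along which \<^term>\<open>T\<close> is dominated by a geometric series.  Closedness of the
  graph identifies the sum of the images with \<open>T x\<close>.
\<close>
theorem closed_graph_imp_bounded_linear:
  fixes T :: "'a::banach \<Rightarrow> 'b::banach"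
  assumes "linear T" and closed: "closed (range (\<lambda>x. (x, T x)))"
  shows "bounded_linear T"
proof -
  interpret T: linear T by fact
  obtain C g where C: "C \<ge> 0"
    and g: "\<And>x \<epsilon>. \<epsilon> > 0 \<Longrightarrow> norm (g x \<epsilon> - x) < \<epsilon> \<and> norm (T (g x \<epsilon>)) \<le> C * norm x"
    using linear_almost_bounded[OF \<open>linear T\<close>] by metis
  have bound: "norm (T x) \<le> norm x * (2 * C)" for x
  proof (cases "x = 0")
    case True
    then show ?thesis by (simp add: T.zero)
  next
    case False
    \<comment> \<open>The remainders of the approximation.\<close>
    define e where "e = rec_nat x (\<lambda>k d. d - g d (norm x / 2 ^ Suc k))"
    have e_0: "e 0 = x" and e_Suc: "e (Suc k) = e k - g (e k) (norm x / 2 ^ Suc k)" for k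
      by (simp_all add: e_def)
    have e_le: "norm (e k) \<le> norm x / 2 ^ k" for k
    proof (cases k)
      case (Suc j)
      with False g[of "norm x / 2 ^ Suc j" "e j"] show ?thesis
        by (simp add: e_Suc norm_minus_commute)
    qed (simp add: e_0)
    have "T (e k) - T (e (Suc k)) = T (g (e k) (norm x / 2 ^ Suc k))" for k
      by (simp add: e_Suc T.diff)
    then have "norm (T (e k) - T (e (Suc k))) \<le> C * norm (e k)" for k
      using False g[of "norm x / 2 ^ Suc k" "e k"] by simp
    also have "C * norm (e k) \<le> C * norm x * (1 / 2) ^ k" for k
      using mult_left_mono[OF e_le[of k] C] by (simp add: power_divide)
    finally have step: "norm (T (e k) - T (e (Suc k))) \<le> C * norm x * (1 / 2) ^ k" for k .
    have geometric: "(\<lambda>k. C * norm x * (1 / 2) ^ k) sums (C * norm x * 2)"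
      using sums_mult[OF geometric_sums[of "1 / 2 :: real"], of "C * norm x"] by simp
    define w where "w = (\<Sum>k. T (e k) - T (e (Suc k)))"
    have summ: "summable (\<lambda>k. T (e k) - T (e (Suc k)))"
      using step by (intro summable_comparison_test[OF _ sums_summable[OF geometric]]) auto
    have "(\<Sum>k<n. T (e k) - T (e (Suc k))) = T (x - e n)" for n
      using sum_lessThan_telescope'[of "\<lambda>k. T (e k)" n] by (simp add: T.diff e_0)
    then have lim_T: "(\<lambda>n. T (x - e n)) \<longlonglongrightarrow> w"
      using summable_LIMSEQ[OF summ] by (simp add: w_def)
    have "(\<lambda>k. norm x * (1 / 2) ^ k) \<longlonglongrightarrow> norm x * 0"
      by (intro tendsto_intros LIMSEQ_realpow_zero) auto
    then have "e \<longlonglongrightarrow> 0"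
      using e_le by (intro Lim_null_comparison[of e]) (auto simp: power_divide)
    then have "(\<lambda>n. x - e n) \<longlonglongrightarrow> x"
      using tendsto_diff[OF tendsto_const[of x], of e 0] by simp
    then have "(\<lambda>n. (x - e n, T (x - e n))) \<longlonglongrightarrow> (x, w)"
      using lim_T by (rule tendsto_Pair)
    then have "(x, w) \<in> range (\<lambda>x. (x, T x))"
      by (rule closed_sequentially[OF closed, rotated]) simp
    then have "T x = w" by auto
    moreover have "norm w \<le> C * norm x * 2"
      unfolding w_def sums_unique[OF geometric]
      by (intro norm_suminf_le step sums_summable[OF geometric])
    ultimately show ?thesis by (simp add: mult_ac)
  qed
  show ?thesis
    by (rule bounded_linear_intro[OF T.add T.scaleR bound])
qed

text \<open>
  Continuity after composition with enough continuous maps suffices: since these maps separate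
  points, the graph is the intersection of the equalizers \<open>{(x, w). f w = f (T x)}\<close>, each of them
  closed.
\<close>
corollary continuous_on_if_separating:
  fixes T :: "'a::banach \<Rightarrow> 'b::banach" and F :: "('b \<Rightarrow> 'c::t2_space) set"
  assumes "linear T"
    and cont: "\<And>f. f \<in> F \<Longrightarrow> continuous_on UNIV f"
    and cont_comp: "\<And>f. f \<in> F \<Longrightarrow> continuous_on UNIV (\<lambda>x. f (T x))"
    and separating: "\<And>w w'. (\<And>f. f \<in> F \<Longrightarrow> f w = f w') \<Longrightarrow> w = w'"
  shows "continuous_on UNIV T"
proof -
  have "range (\<lambda>x. (x, T x)) = (\<Inter>f\<in>F. {p. f (snd p) = f (T (fst p))})"
    using separating by fastforce
  moreover have "closed {p. f (snd p) = f (T (fst p))}" if "f \<in> F" for f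
    by (intro closed_Collect_eq continuous_on_compose2[OF cont[OF that]]
        continuous_on_compose2[OF cont_comp[OF that]] continuous_intros subset_UNIV)
  ultimately have "closed (range (\<lambda>x. (x, T x)))" by auto
  with \<open>linear T\<close> have "bounded_linear T" by (rule closed_graph_imp_bounded_linear)
  then show ?thesis by (rule linear_continuous_on)
qed

section \<open>Complex-linear maps and maps on the semidirect product\<close>

lemma clinear_add: "clinear f \<Longrightarrow> f (x + y) = f x + f y"
  by (rule module_hom.add[OF Vector_Spaces.linear.axioms(3)])

lemma clinear_scaleC: "clinear f \<Longrightarrow> f (c *\<^sub>C x) = c *\<^sub>C f x"
  by (rule module_hom.scale[OF Vector_Spaces.linear.axioms(3)])

lemma clinearI:
  assumes "\<And>x y. f (x + y) = f x + f y" and "\<And>c x. f (c *\<^sub>C x) = c *\<^sub>C f x"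
  shows "clinear f"
  by unfold_locales
    (simp_all add: assms scaleC_add_right scaleC_add_left scaleC_scaleC scaleC_one)

lemma scaleC_zero_right: "c *\<^sub>C (0 :: 'a::complex_vector) = 0"
  using scaleC_add_right[of c 0 "0::'a"] by simp

lemma clinear_zero_map: "clinear (\<lambda>_. 0)"
  by (rule clinearI) (simp_all add: scaleC_zero_right)

lemma clinear_0: "clinear f \<Longrightarrow> f 0 = 0"
  using clinear_add[of f 0 0] by simp

lemma clinear_imp_linear: "clinear f \<Longrightarrow> linear f"
  by (intro linearI) (simp_all add: clinear_add clinear_scaleC scaleR_eq_scaleC)

lemma clinear_bounded_imp_continuous_on:
  fixes f :: "'a::{complex_vector,real_normed_vector} \<Rightarrow> 'b::{complex_vector,real_normed_vector}"
  assumes "clinear f" and "\<And>x. norm (f x) \<le> norm x * K"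
  shows "continuous_on UNIV f"
  using assms clinear_imp_linear[OF assms(1)]
  by (intro linear_continuous_on bounded_linear_intro[of f K])
    (simp_all add: linear_add linear_scale)

text \<open>
  The sum norm lies between the Euclidean norm of the product and twice that norm, so the topology
  is the product topology.
\<close>
lemma semidirect_topology_eq_euclidean:
  "(semidirect_topology :: ('a::complex_banach_algebra \<times> 'u::complex_banach_algebra) topology)
    = euclidean"
proof -
  interpret M: Metric_space UNIV "semidirect_dist :: 'a \<times> 'u \<Rightarrow> _"
    by (rule Metric_space_semidirect)
  have le: "dist p q \<le> semidirect_dist p q" for p q :: "'a \<times> 'u"
    unfolding dist_norm semidirect_dist_def semidirect_norm_def split_beta norm_prod_def
    by (rule sqrt_sum_squares_le_sum) simp_all
  have ge: "semidirect_dist p q \<le> 2 * dist p q" for p q :: "'a \<times> 'u"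
    using norm_fst_le[of "fst (p - q)" "snd (p - q)"] norm_snd_le[of "snd (p - q)" "fst (p - q)"]
    by (simp add: dist_norm semidirect_dist_def semidirect_norm_def split_beta
        del: fst_diff snd_diff)
  have "openin M.mtopology U = open U" for U :: "('a \<times> 'u) set"
  proof
    assume U: "openin M.mtopology U"
    show "open U"
      unfolding open_contains_ball
    proof
      fix p assume "p \<in> U"
      with U obtain r where "r > 0" "M.mball p r \<subseteq> U"
        unfolding M.openin_mtopology by blast
      moreover have "ball p (r / 2) \<subseteq> M.mball p r"
      proof
        fix q assume "q \<in> ball p (r / 2)"
        with ge[of p q] show "q \<in> M.mball p r" by simp
      qed
      ultimately show "\<exists>e>0. ball p e \<subseteq> U" by (intro exI[of _ "r / 2"]) auto
    qed
  next
    assume U: "open U"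
    have "\<exists>r>0. M.mball p r \<subseteq> U" if p: "p \<in> U" for p
    proof -
      obtain r where "r > 0" "ball p r \<subseteq> U" using U p unfolding open_contains_ball by blast
      moreover have "M.mball p r \<subseteq> ball p r"
      proof
        fix q assume "q \<in> M.mball p r"
        with le[of p q] show "q \<in> ball p r" by simp
      qed
      ultimately show ?thesis by blast
    qed
    then show "openin M.mtopology U" by (simp add: M.openin_mtopology)
  qed
  then show ?thesis by (simp add: semidirect_topology_def topology_eq)
qed

definition block_map ::
  "('a \<Rightarrow> 'a) \<Rightarrow> ('a \<Rightarrow> 'u) \<Rightarrow> ('u \<Rightarrow> 'a) \<Rightarrow> ('u \<Rightarrow> 'u) \<Rightarrow> 'a::plus \<times> 'u::plus \<Rightarrow> 'a \<times> 'u"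
  where "block_map d\<^sub>1 d\<^sub>2 t\<^sub>1 t\<^sub>2 = (\<lambda>(a, x). (d\<^sub>1 a + t\<^sub>1 x, d\<^sub>2 a + t\<^sub>2 x))"

lemma clinear_block_map:
  assumes "clinear d\<^sub>1" "clinear d\<^sub>2" "clinear t\<^sub>1" "clinear t\<^sub>2"
  shows "clinear (block_map d\<^sub>1 d\<^sub>2 t\<^sub>1 t\<^sub>2)"
  using assms
  by (intro clinearI)
    (simp_all add: block_map_def split_beta scaleC_prod_def clinear_add clinear_scaleC
      scaleC_add_right algebra_simps)

lemma continuous_map_block_map:
  fixes d\<^sub>1 :: "'a::complex_banach_algebra \<Rightarrow> 'a"
    and d\<^sub>2 :: "'a \<Rightarrow> 'u::complex_banach_algebra"
  assumes "continuous_on UNIV d\<^sub>1" "continuous_on UNIV d\<^sub>2"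
    and "continuous_on UNIV t\<^sub>1" "continuous_on UNIV t\<^sub>2"
  shows "continuous_map semidirect_topology semidirect_topology (block_map d\<^sub>1 d\<^sub>2 t\<^sub>1 t\<^sub>2)"
  unfolding semidirect_topology_eq_euclidean continuous_map_iff_continuous2 block_map_def split_beta
  by (intro continuous_intros assms[THEN continuous_on_compose2] subset_UNIV)

section \<open>Derivations of the semidirect product in components\<close>

context compatible_banach_bimodule
begin

lemmas act_add =
  clinear_add[OF clinear_lact_left] clinear_add[OF clinear_lact_right]
  clinear_add[OF clinear_ract_left] clinear_add[OF clinear_ract_right]

lemmas act_0 =
  clinear_0[OF clinear_lact_left] clinear_0[OF clinear_lact_right]
  clinear_0[OF clinear_ract_left] clinear_0[OF clinear_ract_right]

text \<open>
  Every pair is a sum of elements \<open>(a, 0)\<close> and \<open>(0, x)\<close>, so the Leibniz rule has to be tested only on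
  the four kinds of products of these; each kind gives one identity per component.
\<close>
lemma derivation_block_map_iff:
  assumes "clinear d\<^sub>1" "clinear d\<^sub>2" "clinear t\<^sub>1" "clinear t\<^sub>2"
  shows "derivation (semidirect_mult lact ract) (block_map d\<^sub>1 d\<^sub>2 t\<^sub>1 t\<^sub>2) \<longleftrightarrow>
    (\<forall>a b. d\<^sub>1 (a * b) = a * d\<^sub>1 b + d\<^sub>1 a * b \<and> d\<^sub>2 (a * b) = lact a (d\<^sub>2 b) + ract (d\<^sub>2 a) b) \<and>
    (\<forall>a y. t\<^sub>1 (lact a y) = a * t\<^sub>1 y \<and> t\<^sub>2 (lact a y) = lact a (t\<^sub>2 y) + lact (d\<^sub>1 a) y + d\<^sub>2 a * y) \<and>
    (\<forall>x b. t\<^sub>1 (ract x b) = t\<^sub>1 x * b \<and> t\<^sub>2 (ract x b) = ract x (d\<^sub>1 b) + x * d\<^sub>2 b + ract (t\<^sub>2 x) b) \<and>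
    (\<forall>x y. t\<^sub>1 (x * y) = 0 \<and>
      t\<^sub>2 (x * y) = ract x (t\<^sub>1 y) + x * t\<^sub>2 y + lact (t\<^sub>1 x) y + t\<^sub>2 x * y)"
    (is "?L \<longleftrightarrow> ?R")
proof
  assume ?L
  then have leibniz: "block_map d\<^sub>1 d\<^sub>2 t\<^sub>1 t\<^sub>2 (semidirect_mult lact ract p q) =
      semidirect_mult lact ract p (block_map d\<^sub>1 d\<^sub>2 t\<^sub>1 t\<^sub>2 q)
      + semidirect_mult lact ract (block_map d\<^sub>1 d\<^sub>2 t\<^sub>1 t\<^sub>2 p) q" for p q
    unfolding derivation_def by blast
  note simps = semidirect_mult_def block_map_def act_0 clinear_0[OF assms(1)]
    clinear_0[OF assms(2)] clinear_0[OF assms(3)] clinear_0[OF assms(4)]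
  show ?R
    using leibniz[of "(a, 0)" "(b, 0)" for a b] leibniz[of "(a, 0)" "(0, y)" for a y]
      leibniz[of "(0, x)" "(b, 0)" for x b] leibniz[of "(0, x)" "(0, y)" for x y]
    by (simp add: simps add_ac)
next
  assume ?R
  then show ?L
    using clinear_block_map[OF assms]
    by (simp add: derivation_def semidirect_mult_def block_map_def act_add clinear_add[OF assms(1)]
        clinear_add[OF assms(2)] clinear_add[OF assms(3)] clinear_add[OF assms(4)] algebra_simps)
qed

lemma continuous_on_lact_left: "continuous_on UNIV (\<lambda>a. lact a x)"
  using clinear_lact_left norm_lact by (rule clinear_bounded_imp_continuous_on)

lemma continuous_on_lact_right: "continuous_on UNIV (\<lambda>x. lact a x)"
  using norm_lact[of a]
  by (intro clinear_bounded_imp_continuous_on[OF clinear_lact_right, of _ "norm a"])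
    (simp add: mult.commute)

lemma continuous_on_ract_left: "continuous_on UNIV (\<lambda>x. ract x a)"
  using clinear_ract_left norm_ract by (rule clinear_bounded_imp_continuous_on)

lemma continuous_on_ract_right: "continuous_on UNIV (\<lambda>a. ract x a)"
  using norm_ract[of x]
  by (intro clinear_bounded_imp_continuous_on[OF clinear_ract_right, of _ "norm x"])
    (simp add: mult.commute)

text \<open>
  Solving the module Leibniz rules for \<open>d\<^sub>2 a * y\<close> and \<open>y * d\<^sub>2 a\<close> shows that both are continuous
  in \<open>a\<close>.  A zero annihilator says that multiplications by elements of the algebra separate points,
  so the closed graph theorem makes \<open>d\<^sub>2\<close> itself continuous.  Continuity is required of \<open>d\<^sub>1\<close> only
  through its action, which covers at once continuous \<open>d\<^sub>1\<close> and \<open>d\<^sub>1\<close> that acts as zero.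
\<close>
lemma derivation_block_map_imp_continuous:
  assumes lin: "clinear d\<^sub>1" "clinear d\<^sub>2" "clinear t\<^sub>1" "clinear t\<^sub>2"
    and der: "derivation (semidirect_mult lact ract) (block_map d\<^sub>1 d\<^sub>2 t\<^sub>1 t\<^sub>2)"
    and ann: "(ann_self :: 'u set) = {0}"
    and t\<^sub>2: "continuous_on UNIV t\<^sub>2"
    and d\<^sub>1: "\<And>y. continuous_on UNIV (\<lambda>a. lact (d\<^sub>1 a) y)"
      "\<And>y. continuous_on UNIV (\<lambda>a. ract y (d\<^sub>1 a))"
  shows "continuous_on UNIV d\<^sub>2"
proof -
  have left: "d\<^sub>2 a * y = t\<^sub>2 (lact a y) - lact a (t\<^sub>2 y) - lact (d\<^sub>1 a) y"
    and right: "y * d\<^sub>2 a = t\<^sub>2 (ract y a) - ract (t\<^sub>2 y) a - ract y (d\<^sub>1 a)" for a y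
    using der unfolding derivation_block_map_iff[OF lin] by (simp_all add: algebra_simps)
  define F :: "('u \<Rightarrow> 'u) set" where "F = range (\<lambda>y w. w * y) \<union> range (\<lambda>y w. y * w)"
  show ?thesis
  proof (rule continuous_on_if_separating[of d\<^sub>2 F])
    show "linear d\<^sub>2" using lin(2) by (rule clinear_imp_linear)
  next
    fix f assume "f \<in> F"
    then show "continuous_on UNIV f"
      unfolding F_def by (auto intro!: continuous_intros)
  next
    fix f assume "f \<in> F"
    then show "continuous_on UNIV (\<lambda>a. f (d\<^sub>2 a))"
      unfolding F_def
      by (auto simp: left right intro!: continuous_on_diff d\<^sub>1 continuous_on_lact_left
          continuous_on_ract_right continuous_on_compose2[OF t\<^sub>2])
  next
    fix w w' assume eq: "f w = f w'" if "f \<in> F" for f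
    have "w * y = w' * y" "y * w = y * w'" for y
      using eq[of "\<lambda>w. w * y"] eq[of "\<lambda>w. y * w"] unfolding F_def by blast+
    then have "w - w' \<in> ann_self"
      by (simp add: ann_self_def algebra_simps)
    then have "w - w' \<in> {0}" unfolding ann .
    then show "w = w'" by simp
  qed
qed

end

section \<open>Decomposing a derivation\<close>

theorem proposition3p10:
  fixes lact :: "'a::complex_banach_algebra \<Rightarrow> 'u::complex_banach_algebra \<Rightarrow> 'u"
    and ract :: "'u \<Rightarrow> 'a \<Rightarrow> 'u"
    and D :: "'a \<times> 'u \<Rightarrow> 'a \<times> 'u"
    and \<delta>\<^sub>1 :: "'a \<Rightarrow> 'a" and \<delta>\<^sub>2 :: "'a \<Rightarrow> 'u"
    and \<tau>\<^sub>1 :: "'u \<Rightarrow> 'a" and \<tau>\<^sub>2 :: "'u \<Rightarrow> 'u"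
  assumes "compatible_banach_bimodule lact ract"
    and "derivation (semidirect_mult lact ract) D"
    and "clinear \<delta>\<^sub>1" and "clinear \<delta>\<^sub>2" and "clinear \<tau>\<^sub>1" and "clinear \<tau>\<^sub>2"
    and "\<And>a x. D (a, x) = (\<delta>\<^sub>1 a + \<tau>\<^sub>1 x, \<delta>\<^sub>2 a + \<tau>\<^sub>2 x)"
  shows
    "((ann_self :: 'u set) = {0} \<and> (\<forall>x y. ract x (\<tau>\<^sub>1 y) + lact (\<tau>\<^sub>1 x) y = 0)
        \<and> continuous_on UNIV \<delta>\<^sub>1 \<and> continuous_on UNIV \<tau>\<^sub>2 \<longrightarrow>
      (let D\<^sub>1 = (\<lambda>(a, x). (\<delta>\<^sub>1 a, \<delta>\<^sub>2 a + \<tau>\<^sub>2 x)); D\<^sub>2 = (\<lambda>(a, x). (\<tau>\<^sub>1 x, 0)) in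
        (\<forall>p. D p = D\<^sub>1 p + D\<^sub>2 p)
        \<and> derivation (semidirect_mult lact ract) D\<^sub>1
        \<and> derivation (semidirect_mult lact ract) D\<^sub>2
        \<and> continuous_map semidirect_topology semidirect_topology D\<^sub>1))
    \<and>
     ((ann_self :: 'u set) = {0} \<and> \<delta>\<^sub>1 ` UNIV \<subseteq> ann_module lact ract
        \<and> continuous_on UNIV \<tau>\<^sub>1 \<and> continuous_on UNIV \<tau>\<^sub>2 \<longrightarrow>
      (let D\<^sub>1 = (\<lambda>(a, x). (\<tau>\<^sub>1 x, \<delta>\<^sub>2 a + \<tau>\<^sub>2 x)); D\<^sub>2 = (\<lambda>(a, x). (\<delta>\<^sub>1 a, 0)) in
        derivation (semidirect_mult lact ract) D\<^sub>1
        \<and> continuous_map semidirect_topology semidirect_topology D\<^sub>1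
        \<and> (\<forall>p. D p = D\<^sub>1 p + D\<^sub>2 p)
        \<and> derivation (semidirect_mult lact ract) D\<^sub>2))"
proof -
  interpret compatible_banach_bimodule lact ract by fact
  note lin = assms(3-6)
  have D: "D = block_map \<delta>\<^sub>1 \<delta>\<^sub>2 \<tau>\<^sub>1 \<tau>\<^sub>2"
    using assms(7) by (auto simp: block_map_def)
  have der: "derivation (semidirect_mult lact ract) (block_map \<delta>\<^sub>1 \<delta>\<^sub>2 \<tau>\<^sub>1 \<tau>\<^sub>2)"
    using assms(2) unfolding D .
  \<comment> \<open>All four summands are block maps with some zero entries, so one criterion decides whether
    they are derivations.\<close>
  note zero = clinear_zero_map
  have blocks:
    "(\<lambda>(a, x). (\<delta>\<^sub>1 a, \<delta>\<^sub>2 a + \<tau>\<^sub>2 x)) = block_map \<delta>\<^sub>1 \<delta>\<^sub>2 (\<lambda>_. 0) \<tau>\<^sub>2"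
    "(\<lambda>(a, x). (\<tau>\<^sub>1 x, 0)) = block_map (\<lambda>_. 0) (\<lambda>_. 0) \<tau>\<^sub>1 (\<lambda>_. 0)"
    "(\<lambda>(a, x). (\<tau>\<^sub>1 x, \<delta>\<^sub>2 a + \<tau>\<^sub>2 x)) = block_map (\<lambda>_. 0) \<delta>\<^sub>2 \<tau>\<^sub>1 \<tau>\<^sub>2"
    "(\<lambda>(a, x :: 'u). (\<delta>\<^sub>1 a, 0)) = block_map \<delta>\<^sub>1 (\<lambda>_. 0) (\<lambda>_. 0) (\<lambda>_. 0)"
    by (simp_all add: block_map_def)
  have sums:
    "D p = block_map \<delta>\<^sub>1 \<delta>\<^sub>2 (\<lambda>_. 0) \<tau>\<^sub>2 p + block_map (\<lambda>_. 0) (\<lambda>_. 0) \<tau>\<^sub>1 (\<lambda>_. 0) p"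
    "D p = block_map (\<lambda>_. 0) \<delta>\<^sub>2 \<tau>\<^sub>1 \<tau>\<^sub>2 p + block_map \<delta>\<^sub>1 (\<lambda>_. 0) (\<lambda>_. 0) (\<lambda>_. 0) p" for p
    by (simp_all add: D block_map_def split_beta add_ac)
  show ?thesis
    unfolding Let_def blocks
  proof (intro conjI impI allI sums; elim conjE)
    assume ann: "(ann_self :: 'u set) = {0}"
      and skew: "\<forall>x y. ract x (\<tau>\<^sub>1 y) + lact (\<tau>\<^sub>1 x) y = 0"
      and cont: "continuous_on UNIV \<delta>\<^sub>1" "continuous_on UNIV \<tau>\<^sub>2"
    have skew': "ract x (\<tau>\<^sub>1 y) = - lact (\<tau>\<^sub>1 x) y" for x y
      using skew by (simp add: eq_neg_iff_add_eq_0)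
    show "derivation (semidirect_mult lact ract) (block_map \<delta>\<^sub>1 \<delta>\<^sub>2 (\<lambda>_. 0) \<tau>\<^sub>2)"
      using der
      by (simp add: derivation_block_map_iff lin zero act_0 skew')
    show "derivation (semidirect_mult lact ract) (block_map (\<lambda>_. 0) (\<lambda>_. 0) \<tau>\<^sub>1 (\<lambda>_. 0))"
      using der by (simp add: derivation_block_map_iff lin zero act_0 skew')
    have "continuous_on UNIV \<delta>\<^sub>2"
      by (intro derivation_block_map_imp_continuous[OF lin der ann cont(2)]
          continuous_on_compose2[OF continuous_on_lact_left cont(1)]
          continuous_on_compose2[OF continuous_on_ract_right cont(1)] subset_UNIV)
    with cont show "continuous_map semidirect_topology semidirect_topology
        (block_map \<delta>\<^sub>1 \<delta>\<^sub>2 (\<lambda>_. 0) \<tau>\<^sub>2)"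
      by (intro continuous_map_block_map continuous_on_const)
  next
    assume ann: "(ann_self :: 'u set) = {0}"
      and "range \<delta>\<^sub>1 \<subseteq> ann_module lact ract"
      and cont: "continuous_on UNIV \<tau>\<^sub>1" "continuous_on UNIV \<tau>\<^sub>2"
    then have act: "lact (\<delta>\<^sub>1 a) x = 0" "ract x (\<delta>\<^sub>1 a) = 0" for a x
      by (auto simp: ann_module_def)
    show "derivation (semidirect_mult lact ract) (block_map (\<lambda>_. 0) \<delta>\<^sub>2 \<tau>\<^sub>1 \<tau>\<^sub>2)"
      using der by (simp add: derivation_block_map_iff lin zero act_0 act)
    show "derivation (semidirect_mult lact ract) (block_map \<delta>\<^sub>1 (\<lambda>_. 0) (\<lambda>_. 0) (\<lambda>_. 0))"
      using der by (simp add: derivation_block_map_iff lin zero act_0 act)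
    have "continuous_on UNIV \<delta>\<^sub>2"
      by (rule derivation_block_map_imp_continuous[OF lin der ann cont(2)]) (simp_all add: act)
    with cont show "continuous_map semidirect_topology semidirect_topology
        (block_map (\<lambda>_. 0) \<delta>\<^sub>2 \<tau>\<^sub>1 \<tau>\<^sub>2)"
      by (intro continuous_map_block_map continuous_on_const)
  qed
qed

end
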